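(* Let $R$ be an integral domain with a prime ideal $P$ such that there exists a discrete valuation overring $(V,Q)$ of $R$ centered at $P$ (that is, $Q\cap R=P$), where $Q=xV$. Suppose that $ux^k\in P$ for all units $u$ of $V$ and natural numbers $k\geq 2$, but there is no unit $u$ of $V$ for which $ux\in P$. Then $P$ is a strongly 2-absorbing ideal of $R$ that is not a strongly prime ideal.
   Context: Let $K$ be the quotient field of the integral domain $R$. An overring of $R$ is a ring $T$ with $R\subseteq T\subseteq K$; a discrete valuation overring $(V,Q)$ of $R$ is an overring $V$ that is a (rank one) discrete valuation ring with maximal ideal $Q$. A proper ideal $I$ of $R$ is strongly prime if, whenever $yz\in I$ for elements $y,z\in K$, then $y\in I$ or $z\in I$. A proper ideal $I$ of $R$ is 2-absorbing if whenever $a,b,c\in R$ and $abc\in I$, then $ab\in I$ or $ac\in I$ or $bc\in I$. A 2-absorbing ideal $I$ of $R$ is a strongly 2-absorbing ideal if, whenever $abc\in I$ for elements $a,b,c\in K$, we have $ab\in I$ or $bc\in I$ or $ac\in I$. *)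

theory Defs
  imports "HOL-Algebra.Algebra"
begin

text \<open>
  The integral domain is a subset \<open>R\<close> of its quotient field \<open>K\<close>, and so are the overrings of \<open>R\<close>.
  As a ring in its own right, such a subset \<open>S\<close> is the record \<open>K\<lparr>carrier := S\<rparr>\<close>.
\<close>

definition quotient_field :: "('a, 'b) ring_scheme \<Rightarrow> 'a set \<Rightarrow> bool" where
  "quotient_field K R \<longleftrightarrow> field K \<and> subdomain R K \<and>
     (\<forall>z\<in>carrier K. \<exists>a\<in>R. \<exists>b\<in>R - {\<zero>\<^bsub>K\<^esub>}. z = a \<otimes>\<^bsub>K\<^esub> inv\<^bsub>K\<^esub> b)"

definition overring :: "('a, 'b) ring_scheme \<Rightarrow> 'a set \<Rightarrow> 'a set \<Rightarrow> bool" where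
  "overring K R T \<longleftrightarrow> subring T K \<and> R \<subseteq> T"

text \<open>
  A normalised discrete valuation of rank one: the value group is all of \<open>\<int>\<close>. The value at zero,
  conventionally infinity, is never referred to.
\<close>

definition discrete_valuation :: "('a, 'b) ring_scheme \<Rightarrow> ('a \<Rightarrow> int) \<Rightarrow> bool" where
  "discrete_valuation K v \<longleftrightarrow>
     v ` (carrier K - {\<zero>\<^bsub>K\<^esub>}) = UNIV \<and>
     (\<forall>a\<in>carrier K - {\<zero>\<^bsub>K\<^esub>}. \<forall>b\<in>carrier K - {\<zero>\<^bsub>K\<^esub>}. v (a \<otimes>\<^bsub>K\<^esub> b) = v a + v b) \<and>
     (\<forall>a\<in>carrier K - {\<zero>\<^bsub>K\<^esub>}. \<forall>b\<in>carrier K - {\<zero>\<^bsub>K\<^esub>}.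
        a \<oplus>\<^bsub>K\<^esub> b \<noteq> \<zero>\<^bsub>K\<^esub> \<longrightarrow> v (a \<oplus>\<^bsub>K\<^esub> b) \<ge> min (v a) (v b))"

definition discrete_valuation_ring :: "('a, 'b) ring_scheme \<Rightarrow> 'a set \<Rightarrow> bool" where
  "discrete_valuation_ring K V \<longleftrightarrow>
     (\<exists>v. discrete_valuation K v \<and> V = {a \<in> carrier K. a = \<zero>\<^bsub>K\<^esub> \<or> v a \<ge> 0})"

text \<open>
  Every overring of \<open>R\<close> has quotient field \<open>K\<close>, so it is a discrete valuation ring precisely when
  it is one with respect to a discrete valuation of \<open>K\<close>.
\<close>

definition discrete_valuation_overring ::
    "('a, 'b) ring_scheme \<Rightarrow> 'a set \<Rightarrow> 'a set \<Rightarrow> 'a set \<Rightarrow> bool" where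
  "discrete_valuation_overring K R V Q \<longleftrightarrow>
     overring K R V \<and> discrete_valuation_ring K V \<and> maximalideal Q (K\<lparr>carrier := V\<rparr>)"

definition proper_ideal :: "('a, 'b) ring_scheme \<Rightarrow> 'a set \<Rightarrow> 'a set \<Rightarrow> bool" where
  "proper_ideal K R I \<longleftrightarrow> ideal I (K\<lparr>carrier := R\<rparr>) \<and> I \<noteq> R"

definition strongly_prime :: "('a, 'b) ring_scheme \<Rightarrow> 'a set \<Rightarrow> 'a set \<Rightarrow> bool" where
  "strongly_prime K R I \<longleftrightarrow> proper_ideal K R I \<and>
     (\<forall>y\<in>carrier K. \<forall>z\<in>carrier K. y \<otimes>\<^bsub>K\<^esub> z \<in> I \<longrightarrow> y \<in> I \<or> z \<in> I)"

definition two_absorbing :: "('a, 'b) ring_scheme \<Rightarrow> 'a set \<Rightarrow> 'a set \<Rightarrow> bool" where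
  "two_absorbing K R I \<longleftrightarrow> proper_ideal K R I \<and>
     (\<forall>a\<in>R. \<forall>b\<in>R. \<forall>c\<in>R. a \<otimes>\<^bsub>K\<^esub> b \<otimes>\<^bsub>K\<^esub> c \<in> I \<longrightarrow>
        a \<otimes>\<^bsub>K\<^esub> b \<in> I \<or> a \<otimes>\<^bsub>K\<^esub> c \<in> I \<or> b \<otimes>\<^bsub>K\<^esub> c \<in> I)"

definition strongly_two_absorbing :: "('a, 'b) ring_scheme \<Rightarrow> 'a set \<Rightarrow> 'a set \<Rightarrow> bool" where
  "strongly_two_absorbing K R I \<longleftrightarrow> two_absorbing K R I \<and>
     (\<forall>a\<in>carrier K. \<forall>b\<in>carrier K. \<forall>c\<in>carrier K. a \<otimes>\<^bsub>K\<^esub> b \<otimes>\<^bsub>K\<^esub> c \<in> I \<longrightarrow>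
        a \<otimes>\<^bsub>K\<^esub> b \<in> I \<or> b \<otimes>\<^bsub>K\<^esub> c \<in> I \<or> a \<otimes>\<^bsub>K\<^esub> c \<in> I)"

end

theory Submission
  imports Defs
begin

text \<open>
  If \<open>v\<close> is the normalised valuation of \<open>V\<close>, then \<open>v x = 1\<close> and every nonzero \<open>a\<close> in \<open>K\<close> is
  \<open>u x\<^sup>k\<close> with \<open>u\<close> a unit of \<open>V\<close> and \<open>k = v a\<close>. The hypotheses thus determine \<open>P\<close> completely:
  it consists of \<open>0\<close> and the elements of value at least \<open>2\<close>. If \<open>a b c\<close> is such an element, then
  one of the three pairwise products is, because \<open>2 (v a + v b + v c) \<ge> 4\<close> is the sum of
  their values; and \<open>x x\<close> is such an element while \<open>x\<close> is not.
\<close>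

locale valued_field = field K for K (structure) +
  fixes v :: "'a \<Rightarrow> int"
  assumes valuation: "discrete_valuation K v"
begin

definition valuation_ring :: "'a set" where
  "valuation_ring = {a \<in> carrier K. a = \<zero> \<or> v a \<ge> 0}"

lemma v_mult:
  assumes "a \<in> carrier K" "a \<noteq> \<zero>" "b \<in> carrier K" "b \<noteq> \<zero>"
  shows "v (a \<otimes> b) = v a + v b"
  using valuation assms by (auto simp: discrete_valuation_def)

lemma v_one: "v \<one> = 0"
  using v_mult[of \<one> \<one>] by simp

lemma inv_nonzero:
  assumes "a \<in> carrier K" "a \<noteq> \<zero>"
  shows "inv a \<in> carrier K" "inv a \<noteq> \<zero>" "inv a \<otimes> a = \<one>" "a \<otimes> inv a = \<one>"
proof -
  have "a \<in> Units K" using assms field_Units by auto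
  then show "inv a \<in> carrier K" "inv a \<otimes> a = \<one>" "a \<otimes> inv a = \<one>" by auto
  then show "inv a \<noteq> \<zero>" using assms by auto
qed

lemma v_inv:
  assumes "a \<in> carrier K" "a \<noteq> \<zero>"
  shows "v (inv a) = - v a"
  using v_mult[of a "inv a"] inv_nonzero[OF assms] assms v_one by simp

lemma nat_pow_nonzero:
  assumes "a \<in> carrier K" "a \<noteq> \<zero>"
  shows "a [^] (n::nat) \<noteq> \<zero>"
  using assms by (induction n) (auto simp: integral_iff)

lemma v_pow:
  assumes "a \<in> carrier K" "a \<noteq> \<zero>"
  shows "v (a [^] (n::nat)) = int n * v a"
  using assms by (induction n) (auto simp: v_one v_mult nat_pow_nonzero algebra_simps)

lemma valuation_ring_unit:
  assumes "a \<in> carrier K" "a \<noteq> \<zero>" "v a = 0"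
  shows "a \<in> Units (K\<lparr>carrier := valuation_ring\<rparr>)"
  unfolding Units_def valuation_ring_def
  using assms inv_nonzero[of a] v_inv[of a] by (auto intro!: bexI[of _ "inv a"])

text \<open>The witness is \<open>a\<close> times the inverse of \<open>x [^] k\<close>, which has
  value \<open>k - k = 0\<close>. This translates statements about values into the form of the
  hypotheses on \<open>P\<close>, which speak of units times powers of \<open>x\<close>.\<close>

lemma unit_times_power:
  assumes a: "a \<in> carrier K" "a \<noteq> \<zero>" and x: "x \<in> carrier K" "v x = 1" "x \<noteq> \<zero>"
    and k: "v a = int k"
  obtains u where "u \<in> Units (K\<lparr>carrier := valuation_ring\<rparr>)" "a = u \<otimes> x [^] k"
proof
  let ?y = "x [^] k"
  have y: "?y \<in> carrier K" "?y \<noteq> \<zero>" using x nat_pow_nonzero by auto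
  note i = inv_nonzero[OF y]
  have "v (a \<otimes> inv ?y) = 0"
    using v_mult[OF a i(1,2)] v_inv[OF y] v_pow[of x k] x k by simp
  then show "a \<otimes> inv ?y \<in> Units (K\<lparr>carrier := valuation_ring\<rparr>)"
    using a i by (intro valuation_ring_unit) (auto simp: integral_iff)
  show "a = a \<otimes> inv ?y \<otimes> ?y" using a i y by (simp add: m_assoc)
qed

text \<open>Divisibility in a valuation ring is comparison of values: \<open>b\<close> is the
  multiple \<open>(b \<otimes> inv a) \<otimes> a\<close>, and for nonzero \<open>b\<close> the
  cofactor has value \<open>v b - v a\<close>.\<close>

lemma cgenideal_valuation_ring:
  assumes a: "a \<in> carrier K" "a \<noteq> \<zero>"
  shows "PIdl\<^bsub>K\<lparr>carrier := valuation_ring\<rparr>\<^esub> a = {b \<in> carrier K. b = \<zero> \<or> v b \<ge> v a}"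
    (is "?I = ?J")
proof
  show "?I \<subseteq> ?J"
  proof
    fix b assume "b \<in> ?I"
    then obtain r where r: "r \<in> carrier K" "r = \<zero> \<or> v r \<ge> 0" "b = r \<otimes> a"
      by (auto simp: cgenideal_def valuation_ring_def)
    then show "b \<in> ?J" using a v_mult[of r a] by (cases "r = \<zero>") auto
  qed
  show "?J \<subseteq> ?I"
  proof
    fix b assume b: "b \<in> ?J"
    note i = inv_nonzero[OF a]
    have "b \<otimes> inv a \<in> valuation_ring"
      using b i v_inv[OF a] v_mult[OF _ _ i(1,2), of b] by (cases "b = \<zero>") (auto simp: valuation_ring_def)
    moreover have "b = b \<otimes> inv a \<otimes> a" using a b i by (simp add: m_assoc)
    ultimately show "b \<in> ?I" unfolding cgenideal_def by auto
  qed
qed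

text \<open>Here the normalisation of \<open>v\<close> enters: its values fill all of the
  integers.\<close>

lemma uniformizer_exists:
  obtains t where "t \<in> carrier K" "t \<noteq> \<zero>" "v t = 1"
proof -
  have "1 \<in> v ` (carrier K - {\<zero>})" using valuation by (simp add: discrete_valuation_def)
  then obtain t where "t \<in> carrier K - {\<zero>}" "1 = v t" by (rule imageE)
  then show ?thesis using that[of t] by simp
qed

text \<open>Compare \<open>Q\<close> with the ideal generated by an element \<open>t\<close> of
  value 1. That ideal is proper and contains \<open>x\<close>, so maximality makes the two equal;
  each of \<open>x\<close> and \<open>t\<close> then divides the other.\<close>

lemma maximalideal_generator:
  assumes sub: "subring valuation_ring K"
    and max: "maximalideal Q (K\<lparr>carrier := valuation_ring\<rparr>)"
    and x: "x \<in> valuation_ring"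
    and Q: "Q = PIdl\<^bsub>K\<lparr>carrier := valuation_ring\<rparr>\<^esub> x"
  shows "x \<noteq> \<zero>" "v x = 1"
proof -
  let ?V = "K\<lparr>carrier := valuation_ring\<rparr>"
  obtain t where t: "t \<in> carrier K" "t \<noteq> \<zero>" "v t = 1" by (rule uniformizer_exists)
  interpret V: domain ?V using sub by (rule subring_is_domain)
  have xK: "x \<in> carrier K" and xv: "x = \<zero> \<or> v x \<ge> 0" using x by (auto simp: valuation_ring_def)
  have T: "PIdl\<^bsub>?V\<^esub> t = {b \<in> carrier K. b = \<zero> \<or> v b \<ge> 1}"
    using cgenideal_valuation_ring[OF t(1,2)] t by simp
  have one: "\<one> \<in> valuation_ring" by (simp add: valuation_ring_def v_one)
  \<comment> \<open>An element of value 0 would generate the whole ring. As values are integers, a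
    nonzero \<open>x\<close> thus has value at least 1.\<close>
  have "v x \<noteq> 0" if "x \<noteq> \<zero>"
  proof
    assume "v x = 0"
    then have "Q = valuation_ring"
      using cgenideal_valuation_ring[OF xK that] Q by (simp add: valuation_ring_def)
    then show False using maximalideal.I_notcarr[OF max] by simp
  qed
  then have "x \<in> PIdl\<^bsub>?V\<^esub> t"
    unfolding T using xK xv by force
  moreover have tI: "ideal (PIdl\<^bsub>?V\<^esub> t) ?V"
    using t by (intro V.cgenideal_ideal) (simp add: valuation_ring_def)
  ultimately have sub_t: "Q \<subseteq> PIdl\<^bsub>?V\<^esub> t"
    unfolding Q by (rule V.cgenideal_minimal[rotated])
  have "PIdl\<^bsub>?V\<^esub> t \<subseteq> carrier ?V" unfolding T by (auto simp: valuation_ring_def)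
  moreover have "PIdl\<^bsub>?V\<^esub> t \<noteq> carrier ?V"
  proof -
    have "\<one> \<notin> PIdl\<^bsub>?V\<^esub> t" unfolding T by (simp add: v_one)
    then show ?thesis using one by auto
  qed
  ultimately have QT: "Q = PIdl\<^bsub>?V\<^esub> t"
    using maximalideal.I_maximal[OF max tI sub_t] by auto
  then have tQ: "t \<in> Q" unfolding T using t by simp
  show x0: "x \<noteq> \<zero>"
  proof
    assume "x = \<zero>"
    then show False using tQ t unfolding Q by (auto simp: cgenideal_def valuation_ring_def)
  qed
  have "v x \<le> 1" using tQ cgenideal_valuation_ring[OF xK x0] t Q by auto
  moreover have "x \<in> Q" using cgenideal_valuation_ring[OF xK x0] xK Q by simp
  then have "v x \<ge> 1" unfolding QT T using x0 by simp
  ultimately show "v x = 1" by simp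
qed

lemma value_two_ideal_absorbs:
  assumes P: "P = {a \<in> carrier K. a = \<zero> \<or> v a \<ge> 2}"
    and abc: "a \<in> carrier K" "b \<in> carrier K" "c \<in> carrier K" "a \<otimes> b \<otimes> c \<in> P"
  shows "a \<otimes> b \<in> P \<or> b \<otimes> c \<in> P \<or> a \<otimes> c \<in> P"
\<comment> \<open>The value at zero is arbitrary, so zero factors are set apart; with one of them
  some pairwise product is zero.\<close>
proof (cases "a = \<zero> \<or> b = \<zero> \<or> c = \<zero>")
  case True
  then show ?thesis using abc P by auto
next
  case False
  then have "v a + v b + v c \<ge> 2"
    using abc P by (auto simp: v_mult integral_iff)
  \<comment> \<open>Integrality matters: otherwise each sum is at most 1, and together they are at
    most 3 instead of at least 4.\<close>
  then have "v a + v b \<ge> 2 \<or> v b + v c \<ge> 2 \<or> v a + v c \<ge> 2" by linarith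
  then show ?thesis using False abc P by (auto simp: v_mult)
qed

end

theorem proposition3p6:
  fixes K :: "('a, 'b) ring_scheme" and R P V Q :: "'a set" and x :: 'a
  assumes "quotient_field K R"
    and "primeideal P (K\<lparr>carrier := R\<rparr>)"
    and "discrete_valuation_overring K R V Q"
    and "Q \<inter> R = P"
    and "x \<in> V"
    and "Q = PIdl\<^bsub>K\<lparr>carrier := V\<rparr>\<^esub> x"
    and "\<And>u (k::nat). u \<in> Units (K\<lparr>carrier := V\<rparr>) \<Longrightarrow> k \<ge> 2 \<Longrightarrow>
           u \<otimes>\<^bsub>K\<^esub> x [^]\<^bsub>K\<^esub> k \<in> P"
    and "\<not> (\<exists>u \<in> Units (K\<lparr>carrier := V\<rparr>). u \<otimes>\<^bsub>K\<^esub> x \<in> P)"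
  shows "strongly_two_absorbing K R P \<and> \<not> strongly_prime K R P"
proof -
  from assms(3) obtain v where v: "discrete_valuation K v"
    and V: "V = {a \<in> carrier K. a = \<zero>\<^bsub>K\<^esub> \<or> v a \<ge> 0}"
    and sub: "subring V K" and max: "maximalideal Q (K\<lparr>carrier := V\<rparr>)"
    by (auto simp: discrete_valuation_overring_def discrete_valuation_ring_def overring_def)
  interpret field K using assms(1) by (simp add: quotient_field_def)
  interpret valued_field K v using v by unfold_locales
  have VV: "V = valuation_ring" by (simp add: V valuation_ring_def)
  have xK: "x \<in> carrier K" using assms(5) V by simp
  have x: "x \<noteq> \<zero>\<^bsub>K\<^esub>" "v x = 1"
    by (rule maximalideal_generator[OF sub[unfolded VV] max[unfolded VV]
        assms(5)[unfolded VV] assms(6)[unfolded VV]])+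
  have Q: "Q = {b \<in> carrier K. b = \<zero>\<^bsub>K\<^esub> \<or> v b \<ge> 1}"
    using cgenideal_valuation_ring[OF xK x(1)] assms(6) x(2) VV by simp
  interpret P: primeideal P "K\<lparr>carrier := R\<rparr>" by (rule assms(2))
  have R: "R \<subseteq> carrier K"
    using assms(1) by (auto simp: quotient_field_def dest: subdomainE(1))
  have P: "P = {a \<in> carrier K. a = \<zero>\<^bsub>K\<^esub> \<or> v a \<ge> 2}" (is "P = ?M")
  proof (intro subset_antisym subsetI)
    fix a assume a: "a \<in> P"
    then have aQ: "a \<in> carrier K" "a = \<zero>\<^bsub>K\<^esub> \<or> v a \<ge> 1" using assms(4) Q by auto
    \<comment> \<open>Membership in \<open>Q\<close> gives value at least 1. Value exactly 1 would
      make \<open>a\<close> a unit times \<open>x\<close>, which is excluded from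
      \<open>P\<close>.\<close>
    have "v a \<noteq> 1" if a0: "a \<noteq> \<zero>\<^bsub>K\<^esub>"
    proof
      assume "v a = 1"
      then obtain u where "u \<in> Units (K\<lparr>carrier := V\<rparr>)" "a = u \<otimes>\<^bsub>K\<^esub> x [^]\<^bsub>K\<^esub> (1::nat)"
        using unit_times_power[OF aQ(1) a0 xK x(2,1), of 1] VV by auto
      then show False using assms(8) a xK by auto
    qed
    then show "a \<in> ?M" using aQ by force
  next
    fix a assume a: "a \<in> ?M"
    show "a \<in> P"
    proof (cases "a = \<zero>\<^bsub>K\<^esub>")
      case True
      then show ?thesis using additive_subgroup.zero_closed[OF P.additive_subgroup_axioms] by simp
    next
      case False
      then have "v a = int (nat (v a))" "nat (v a) \<ge> 2" using a by auto
      moreover have "a \<in> carrier K" using a by simp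
      ultimately obtain u where u: "u \<in> Units (K\<lparr>carrier := V\<rparr>)"
        and au: "a = u \<otimes>\<^bsub>K\<^esub> x [^]\<^bsub>K\<^esub> nat (v a)"
        using unit_times_power[OF _ False xK x(2,1)] VV by blast
      \<comment> \<open>The right side of \<open>au\<close> contains \<open>a\<close> again, in the
        exponent, so the equation is applied just once.\<close>
      show ?thesis by (subst au) (rule assms(7)[OF u \<open>nat (v a) \<ge> 2\<close>])
    qed
  qed
  have proper: "proper_ideal K R P"
    using P.is_ideal P.I_notcarr by (auto simp: proper_ideal_def)
  have "strongly_two_absorbing K R P"
    unfolding strongly_two_absorbing_def two_absorbing_def
  \<comment> \<open>Absorption over \<open>K\<close> restricts to \<open>R\<close>; the two
    definitions list the three products in different orders.\<close>
  proof (intro conjI ballI impI proper)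
    fix a b c assume "a \<in> R" "b \<in> R" "c \<in> R" "a \<otimes>\<^bsub>K\<^esub> b \<otimes>\<^bsub>K\<^esub> c \<in> P"
    then show "a \<otimes>\<^bsub>K\<^esub> b \<in> P \<or> a \<otimes>\<^bsub>K\<^esub> c \<in> P \<or> b \<otimes>\<^bsub>K\<^esub> c \<in> P"
      using value_two_ideal_absorbs[OF P, of a b c] R by blast
  qed (rule value_two_ideal_absorbs[OF P])
  moreover have "x \<otimes>\<^bsub>K\<^esub> x \<in> P" "x \<notin> P" using P xK x by (auto simp: v_mult)
  then have "\<not> strongly_prime K R P" using xK by (auto simp: strongly_prime_def)
  ultimately show ?thesis by blast
qed

end
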